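(* Let $G$ be a group that admits a topologically free, extremely proximal action $G\curvearrowright X$ by homeomorphisms on a Hausdorff space $X$ with more than two points. Then $G$ is mixed-identity-free and contains a non-abelian free subgroup.
   Context: Let $G$ be a group and let $X$ be a Hausdorff space with $\#X>2$. An action by homeomorphisms $G\curvearrowright X$ is said to be: (1) an extremely proximal action if, for every pair of non-empty open subsets $U,V\subseteq X$, there exists $g\in G$ such that $g(X\setminus U)\subseteq V$; (2) topologically free if, for every $g\in G\setminus\{1\}$, the set of points of $X$ fixed by $g$ is nowhere dense. A group $G$ is mixed-identity-free (MIF) if, for every $n\in \mathbb{N}$ and every $w\in G*\mathbb{F}_n$ with $w\neq 1$, there is a group homomorphism $G*\mathbb{F}_n\to G$, restricting to the identity on $G$, that does not send $w$ to $1$. Here $\mathbb{F}_n$ is the free group of rank $n$ and $*$ denotes the free product of groups. *)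

theory Defs
  imports "HOL-Analysis.Analysis" "HOL-Algebra.Group_Action"
begin

section \<open>Monoid presentations\<close>

inductive_set word_cong :: "'a set \<Rightarrow> ('a list \<times> 'a list) set \<Rightarrow> ('a list \<times> 'a list) set"
  for A :: "'a set" and R :: "('a list \<times> 'a list) set" where
  refl: "w \<in> lists A \<Longrightarrow> (w, w) \<in> word_cong A R"
| sym: "(u, v) \<in> word_cong A R \<Longrightarrow> (v, u) \<in> word_cong A R"
| trans: "(u, v) \<in> word_cong A R \<Longrightarrow> (v, w) \<in> word_cong A R \<Longrightarrow> (u, w) \<in> word_cong A R"
| rel: "(u, v) \<in> R \<Longrightarrow> u \<in> lists A \<Longrightarrow> v \<in> lists A \<Longrightarrow> p \<in> lists A \<Longrightarrow> q \<in> lists A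
          \<Longrightarrow> (p @ u @ q, p @ v @ q) \<in> word_cong A R"

abbreviation word_class :: "'a set \<Rightarrow> ('a list \<times> 'a list) set \<Rightarrow> 'a list \<Rightarrow> 'a list set" where
  "word_class A R w \<equiv> word_cong A R `` {w}"

definition presented_monoid :: "'a set \<Rightarrow> ('a list \<times> 'a list) set \<Rightarrow> 'a list set monoid" where
  "presented_monoid A R =
     \<lparr>carrier = lists A // word_cong A R,
      mult = (\<lambda>X Y. \<Union>x\<in>X. \<Union>y\<in>Y. word_class A R (x @ y)),
      one = word_class A R []\<rparr>"

section \<open>Free groups and free products\<close>

text \<open>In a free group the letter \<open>(s, True)\<close> stands for the generator \<open>s\<close> and
  \<open>(s, False)\<close> for its formal inverse.\<close>

definition free_group_rels :: "'s set \<Rightarrow> (('s \<times> bool) list \<times> ('s \<times> bool) list) set" where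
  "free_group_rels S = {([(s, b), (s, \<not> b)], []) | s b. s \<in> S}"

definition free_group :: "'s set \<Rightarrow> ('s \<times> bool) list set monoid" where
  "free_group S = presented_monoid (S \<times> UNIV) (free_group_rels S)"

definition free_group_gen :: "'s set \<Rightarrow> 's \<Rightarrow> ('s \<times> bool) list set" where
  "free_group_gen S s = word_class (S \<times> UNIV) (free_group_rels S) [(s, True)]"

text \<open>The letters of the free product are the elements of the two groups; a word may be simplified
  by multiplying adjacent letters from the same group, or by deleting a neutral element.\<close>

definition free_product_rels ::
    "('a, 'm) monoid_scheme \<Rightarrow> ('b, 'k) monoid_scheme \<Rightarrow> (('a + 'b) list \<times> ('a + 'b) list) set" where
  "free_product_rels G H =
     {([Inl x, Inl y], [Inl (x \<otimes>\<^bsub>G\<^esub> y)]) | x y. x \<in> carrier G \<and> y \<in> carrier G} \<union>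
     {([Inr x, Inr y], [Inr (x \<otimes>\<^bsub>H\<^esub> y)]) | x y. x \<in> carrier H \<and> y \<in> carrier H} \<union>
     {([Inl \<one>\<^bsub>G\<^esub>], []), ([Inr \<one>\<^bsub>H\<^esub>], [])}"

definition free_product ::
    "('a, 'm) monoid_scheme \<Rightarrow> ('b, 'k) monoid_scheme \<Rightarrow> ('a + 'b) list set monoid" where
  "free_product G H = presented_monoid (carrier G <+> carrier H) (free_product_rels G H)"

definition free_product_inl ::
    "('a, 'm) monoid_scheme \<Rightarrow> ('b, 'k) monoid_scheme \<Rightarrow> 'a \<Rightarrow> ('a + 'b) list set" where
  "free_product_inl G H x = word_class (carrier G <+> carrier H) (free_product_rels G H) [Inl x]"

definition free_product_inr ::
    "('a, 'm) monoid_scheme \<Rightarrow> ('b, 'k) monoid_scheme \<Rightarrow> 'b \<Rightarrow> ('a + 'b) list set" where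
  "free_product_inr G H y = word_class (carrier G <+> carrier H) (free_product_rels G H) [Inr y]"

text \<open>A basis of a free group on \<open>'a\<close> is a subset of its carrier, so it is no
  restriction to take the index set of the generators in the type \<open>'a\<close>.\<close>

definition is_free_group :: "('a, 'm) monoid_scheme \<Rightarrow> bool" where
  "is_free_group K \<longleftrightarrow> group K \<and> (\<exists>S :: 'a set. free_group S \<cong> K)"

definition mixed_identity_free :: "('a, 'm) monoid_scheme \<Rightarrow> bool" where
  "mixed_identity_free G \<longleftrightarrow>
     (\<forall>n :: nat. let F = free_group {..<n} in
        \<forall>w \<in> carrier (free_product G F). w \<noteq> \<one>\<^bsub>free_product G F\<^esub> \<longrightarrow>
          (\<exists>h \<in> hom (free_product G F) G.
             (\<forall>g \<in> carrier G. h (free_product_inl G F g) = g) \<and> h w \<noteq> \<one>\<^bsub>G\<^esub>))"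

section \<open>Actions by homeomorphisms\<close>

definition action_by_homeos ::
    "('g, 'm) monoid_scheme \<Rightarrow> 'x topology \<Rightarrow> ('g \<Rightarrow> 'x \<Rightarrow> 'x) \<Rightarrow> bool" where
  "action_by_homeos G X \<phi> \<longleftrightarrow>
     group_action G (topspace X) \<phi> \<and> (\<forall>g \<in> carrier G. homeomorphic_map X X (\<phi> g))"

definition extremely_proximal ::
    "('g, 'm) monoid_scheme \<Rightarrow> 'x topology \<Rightarrow> ('g \<Rightarrow> 'x \<Rightarrow> 'x) \<Rightarrow> bool" where
  "extremely_proximal G X \<phi> \<longleftrightarrow>
     (\<forall>U V. openin X U \<and> U \<noteq> {} \<and> openin X V \<and> V \<noteq> {} \<longrightarrow>
        (\<exists>g \<in> carrier G. \<phi> g ` (topspace X - U) \<subseteq> V))"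

definition nowhere_dense_in :: "'x topology \<Rightarrow> 'x set \<Rightarrow> bool" where
  "nowhere_dense_in X S \<longleftrightarrow> S \<subseteq> topspace X \<and> X interior_of (X closure_of S) = {}"

definition topologically_free ::
    "('g, 'm) monoid_scheme \<Rightarrow> 'x topology \<Rightarrow> ('g \<Rightarrow> 'x \<Rightarrow> 'x) \<Rightarrow> bool" where
  "topologically_free G X \<phi> \<longleftrightarrow>
     (\<forall>g \<in> carrier G - {\<one>\<^bsub>G\<^esub>}. nowhere_dense_in X (invariants (topspace X) \<phi> g))"

section \<open>The constructions have the expected properties\<close>

lemma word_cong_lists: "(u, v) \<in> word_cong A R \<Longrightarrow> u \<in> lists A \<and> v \<in> lists A"
  by (induction rule: word_cong.induct) auto

lemma equiv_word_cong: "equiv (lists A) (word_cong A R)"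
proof (rule equivI)
  show "word_cong A R \<subseteq> lists A \<times> lists A"
    using word_cong_lists by fast
  show "refl_on (lists A) (word_cong A R)"
    by (rule refl_onI) (rule word_cong.refl)
  show "sym (word_cong A R)"
    by (rule symI) (rule word_cong.sym)
  show "trans (word_cong A R)"
    by (rule transI) (rule word_cong.trans)
qed

lemma word_cong_context:
  assumes "(u, v) \<in> word_cong A R" "p \<in> lists A" "q \<in> lists A"
  shows "(p @ u @ q, p @ v @ q) \<in> word_cong A R"
  using assms
proof (induction rule: word_cong.induct)
  case (refl w)
  then show ?case by (intro word_cong.refl) auto
next
  case (sym u v)
  then show ?case by (blast intro: word_cong.sym)
next
  case (trans u v w)
  then show ?case by (blast intro: word_cong.trans)
next
  case (rel u v p' q')
  then show ?case
    using word_cong.rel[of u v R A "p @ p'" "q' @ q"] by simp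
qed

lemma word_cong_append:
  assumes "(u, u') \<in> word_cong A R" "(v, v') \<in> word_cong A R"
  shows "(u @ v, u' @ v') \<in> word_cong A R"
proof (rule word_cong.trans)
  show "(u @ v, u' @ v) \<in> word_cong A R"
    using word_cong_context[OF assms(1), of "[]" v] word_cong_lists[OF assms(2)] by simp
  show "(u' @ v, u' @ v') \<in> word_cong A R"
    using word_cong_context[OF assms(2), of u' "[]"] word_cong_lists[OF assms(1)] by simp
qed

lemma word_class_eq_iff:
  assumes "u \<in> lists A" "v \<in> lists A"
  shows "word_class A R u = word_class A R v \<longleftrightarrow> (u, v) \<in> word_cong A R"
  using assms equiv_word_cong[of A R] by (simp only: eq_equiv_class_iff)

lemma presented_monoid_mult:
  assumes "u \<in> lists A" "v \<in> lists A"
  shows "word_class A R u \<otimes>\<^bsub>presented_monoid A R\<^esub> word_class A R v = word_class A R (u @ v)"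
proof -
  have *: "word_class A R (x @ y) = word_class A R (u @ v)"
    if x: "x \<in> word_class A R u" and y: "y \<in> word_class A R v" for x y
  proof -
    have "(u @ v, x @ y) \<in> word_cong A R"
      using x y by (intro word_cong_append) simp_all
    then show ?thesis
      by (rule equiv_class_eq[OF equiv_word_cong, symmetric])
  qed
  have mem: "u \<in> word_class A R u" "v \<in> word_class A R v"
    using assms by (auto intro: word_cong.refl)
  have "(\<Union>x\<in>word_class A R u. \<Union>y\<in>word_class A R v. word_class A R (x @ y)) =
      (\<Union>x\<in>word_class A R u. \<Union>y\<in>word_class A R v. word_class A R (u @ v))"
    by (intro SUP_cong HOL.refl *)
  also have "\<dots> = word_class A R (u @ v)"
    using mem by blast
  finally show ?thesis
    by (simp add: presented_monoid_def)
qed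

lemma presented_monoid_carrierE:
  assumes "X \<in> carrier (presented_monoid A R)"
  obtains w where "w \<in> lists A" "X = word_class A R w"
  using assms by (auto simp: presented_monoid_def elim!: quotientE)

lemma word_class_carrier:
  "w \<in> lists A \<Longrightarrow> word_class A R w \<in> carrier (presented_monoid A R)"
  by (simp add: presented_monoid_def quotientI)

lemma presented_monoid_one: "\<one>\<^bsub>presented_monoid A R\<^esub> = word_class A R []"
  by (simp add: presented_monoid_def)

lemma group_presented_monoid:
  assumes "\<And>a. a \<in> A \<Longrightarrow> \<exists>b\<in>A. ([b, a], []) \<in> word_cong A R"
  shows "group (presented_monoid A R)"
proof (rule groupI)
  fix X Y Z
  assume "X \<in> carrier (presented_monoid A R)" "Y \<in> carrier (presented_monoid A R)"
    "Z \<in> carrier (presented_monoid A R)"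
  then show "X \<otimes>\<^bsub>presented_monoid A R\<^esub> Y \<otimes>\<^bsub>presented_monoid A R\<^esub> Z =
      X \<otimes>\<^bsub>presented_monoid A R\<^esub> (Y \<otimes>\<^bsub>presented_monoid A R\<^esub> Z)"
    by (elim presented_monoid_carrierE) (simp add: presented_monoid_mult)
next
  fix X Y
  assume "X \<in> carrier (presented_monoid A R)" "Y \<in> carrier (presented_monoid A R)"
  then show "X \<otimes>\<^bsub>presented_monoid A R\<^esub> Y \<in> carrier (presented_monoid A R)"
    by (elim presented_monoid_carrierE) (simp add: presented_monoid_mult word_class_carrier)
next
  show "\<one>\<^bsub>presented_monoid A R\<^esub> \<in> carrier (presented_monoid A R)"
    by (simp add: presented_monoid_one word_class_carrier)
next
  fix X
  assume "X \<in> carrier (presented_monoid A R)"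
  then show "\<one>\<^bsub>presented_monoid A R\<^esub> \<otimes>\<^bsub>presented_monoid A R\<^esub> X = X"
    by (elim presented_monoid_carrierE) (simp add: presented_monoid_mult presented_monoid_one)
next
  fix X
  assume "X \<in> carrier (presented_monoid A R)"
  then obtain w where w: "w \<in> lists A" and X: "X = word_class A R w"
    by (rule presented_monoid_carrierE)
  from w have "\<exists>v\<in>lists A. (v @ w, []) \<in> word_cong A R"
  proof (induction w)
    case Nil
    then show ?case by (auto intro!: bexI[of _ "[]"] word_cong.refl)
  next
    case (Cons a w)
    then obtain v where v: "v \<in> lists A" "(v @ w, []) \<in> word_cong A R" by auto
    obtain b where b: "b \<in> A" "([b, a], []) \<in> word_cong A R" using assms Cons.hyps by blast
    have "((v @ [b]) @ a # w, v @ w) \<in> word_cong A R"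
      using word_cong_context[OF b(2) v(1), of w] Cons by simp
    from word_cong.trans[OF this v(2)] show ?case
      using v b by (intro bexI[of _ "v @ [b]"]) auto
  qed
  then obtain v where v: "v \<in> lists A" "(v @ w, []) \<in> word_cong A R" by blast
  have "word_class A R (v @ w) = word_class A R []"
    using v(2) by (rule equiv_class_eq[OF equiv_word_cong])
  then have "word_class A R v \<otimes>\<^bsub>presented_monoid A R\<^esub> X = \<one>\<^bsub>presented_monoid A R\<^esub>"
    using v w by (simp add: X presented_monoid_mult presented_monoid_one)
  then show "\<exists>Y\<in>carrier (presented_monoid A R).
      Y \<otimes>\<^bsub>presented_monoid A R\<^esub> X = \<one>\<^bsub>presented_monoid A R\<^esub>"
    using word_class_carrier[OF v(1)] by blast
qed

definition (in monoid) word_eval :: "('c \<Rightarrow> 'a) \<Rightarrow> 'c list \<Rightarrow> 'a" where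
  "word_eval f w = foldr (\<lambda>a x. f a \<otimes> x) w \<one>"

lemma (in monoid) word_eval_Nil [simp]: "word_eval f [] = \<one>"
  and word_eval_Cons [simp]: "word_eval f (a # w) = f a \<otimes> word_eval f w"
  by (simp_all add: word_eval_def)

lemma (in monoid) word_eval_closed:
  "f \<in> A \<rightarrow> carrier G \<Longrightarrow> w \<in> lists A \<Longrightarrow> word_eval f w \<in> carrier G"
  by (induction w) auto

lemma (in monoid) word_eval_append:
  "f \<in> A \<rightarrow> carrier G \<Longrightarrow> u \<in> lists A \<Longrightarrow> v \<in> lists A \<Longrightarrow>
     word_eval f (u @ v) = word_eval f u \<otimes> word_eval f v"
  by (induction u) (auto simp: m_assoc word_eval_closed Pi_iff)

lemma (in monoid) word_eval_cong:
  assumes "(u, v) \<in> word_cong A R" "f \<in> A \<rightarrow> carrier G"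
    and "\<And>u v. (u, v) \<in> R \<Longrightarrow> word_eval f u = word_eval f v"
  shows "word_eval f u = word_eval f v"
  using assms(1)
proof (induction rule: word_cong.induct)
  case (rel u v p q)
  then show ?case
    using assms(3)[OF rel(1)] by (simp add: word_eval_append[OF assms(2)] del: in_lists_conv_set)
qed auto

lemma (in monoid) presented_monoid_universal:
  assumes f: "f \<in> A \<rightarrow> carrier G"
    and R: "\<And>u v. (u, v) \<in> R \<Longrightarrow> word_eval f u = word_eval f v"
  obtains h where "h \<in> hom (presented_monoid A R) G"
    "\<And>w. w \<in> lists A \<Longrightarrow> h (word_class A R w) = word_eval f w"
proof
  define h where "h X = word_eval f (SOME w. w \<in> X)" for X
  show h: "h (word_class A R w) = word_eval f w" if "w \<in> lists A" for w
  proof -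
    have "w \<in> word_class A R w" using that by (auto intro: word_cong.refl)
    then have "(SOME v. v \<in> word_class A R w) \<in> word_class A R w" by (rule someI)
    then have "(w, SOME v. v \<in> word_class A R w) \<in> word_cong A R" by blast
    from word_eval_cong[OF this f R] show ?thesis by (simp add: h_def)
  qed
  show "h \<in> hom (presented_monoid A R) G"
  proof (rule homI)
    fix X assume "X \<in> carrier (presented_monoid A R)"
    then show "h X \<in> carrier G"
      by (elim presented_monoid_carrierE) (simp add: h word_eval_closed[OF f] del: in_lists_conv_set)
  next
    fix X Y assume "X \<in> carrier (presented_monoid A R)" "Y \<in> carrier (presented_monoid A R)"
    then show "h (X \<otimes>\<^bsub>presented_monoid A R\<^esub> Y) = h X \<otimes> h Y"
      by (elim presented_monoid_carrierE)
        (simp add: h presented_monoid_mult word_eval_append[OF f] del: in_lists_conv_set)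
  qed
qed

lemma group_free_group: "group (free_group S)"
  unfolding free_group_def
proof (rule group_presented_monoid)
  fix a :: "'a \<times> bool" assume a: "a \<in> S \<times> UNIV"
  obtain s b where ab: "a = (s, b)" by (cases a)
  then have "([(s, \<not> b), a], []) \<in> free_group_rels S"
    using a by (force simp: free_group_rels_def)
  from word_cong.rel[OF this, of "S \<times> UNIV" "[]" "[]"]
  show "\<exists>b\<in>S \<times> UNIV. ([b, a], []) \<in> word_cong (S \<times> UNIV) (free_group_rels S)"
    using a ab by (intro bexI[of _ "(s, \<not> b)"]) auto
qed

lemma free_group_universal:
  assumes "group K" "f \<in> S \<rightarrow> carrier K"
  obtains h where "h \<in> hom (free_group S) K"
    "\<And>s. s \<in> S \<Longrightarrow> h (free_group_gen S s) = f s"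
proof -
  interpret K: group K by fact
  let ?g = "\<lambda>(s, b). if b then f s else inv\<^bsub>K\<^esub> (f s)"
  have g: "?g \<in> S \<times> UNIV \<rightarrow> carrier K" using assms(2) by (auto simp: Pi_iff)
  obtain h where h: "h \<in> hom (free_group S) K"
    "\<And>w. w \<in> lists (S \<times> UNIV) \<Longrightarrow>
      h (word_class (S \<times> UNIV) (free_group_rels S) w) = K.word_eval ?g w"
    unfolding free_group_def
  proof (rule K.presented_monoid_universal[OF g])
    fix u v assume "(u, v) \<in> free_group_rels S"
    then obtain s b where "u = [(s, b), (s, \<not> b)]" "v = []" "f s \<in> carrier K"
      using assms(2) by (auto simp: free_group_rels_def)
    then show "K.word_eval ?g u = K.word_eval ?g v" by (cases b) simp_all
  qed blast
  show thesis
  proof (rule that[OF h(1)])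
    fix s assume s: "s \<in> S"
    then have "f s \<in> carrier K" using assms(2) by blast
    with s show "h (free_group_gen S s) = f s"
      unfolding free_group_gen_def by (subst h(2)) simp_all
  qed
qed

lemma group_free_product:
  assumes "group G" "group H"
  shows "group (free_product G H)"
  unfolding free_product_def
proof (rule group_presented_monoid)
  interpret G: group G by fact
  interpret H: group H by fact
  let ?A = "carrier G <+> carrier H" and ?R = "free_product_rels G H"
  fix a assume "a \<in> ?A"
  then consider x where "a = Inl x" "x \<in> carrier G" | y where "a = Inr y" "y \<in> carrier H" by auto
  then show "\<exists>b\<in>?A. ([b, a], []) \<in> word_cong ?A ?R"
  proof cases
    case 1
    have "([Inl (inv\<^bsub>G\<^esub> x), Inl x], [Inl (inv\<^bsub>G\<^esub> x \<otimes>\<^bsub>G\<^esub> x)]) \<in> ?R"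
      using 1 G.inv_closed[of x] unfolding free_product_rels_def by blast
    from word_cong.rel[OF this, of ?A "[]" "[]"]
    have *: "([Inl (inv\<^bsub>G\<^esub> x), Inl x], [Inl \<one>\<^bsub>G\<^esub>]) \<in> word_cong ?A ?R"
      using 1 by (simp add: InlI)
    have "([Inl \<one>\<^bsub>G\<^esub>], []) \<in> ?R" unfolding free_product_rels_def by blast
    from word_cong.rel[OF this, of ?A "[]" "[]"]
    have "([Inl \<one>\<^bsub>G\<^esub>], []) \<in> word_cong ?A ?R" by (simp add: InlI)
    from word_cong.trans[OF * this] show ?thesis
      using 1 G.inv_closed[of x] by (blast intro: InlI)
  next
    case 2
    have "([Inr (inv\<^bsub>H\<^esub> y), Inr y], [Inr (inv\<^bsub>H\<^esub> y \<otimes>\<^bsub>H\<^esub> y)]) \<in> ?R"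
      using 2 H.inv_closed[of y] unfolding free_product_rels_def by blast
    from word_cong.rel[OF this, of ?A "[]" "[]"]
    have *: "([Inr (inv\<^bsub>H\<^esub> y), Inr y], [Inr \<one>\<^bsub>H\<^esub>]) \<in> word_cong ?A ?R"
      using 2 by (simp add: InrI)
    have "([Inr \<one>\<^bsub>H\<^esub>], []) \<in> ?R" unfolding free_product_rels_def by blast
    from word_cong.rel[OF this, of ?A "[]" "[]"]
    have "([Inr \<one>\<^bsub>H\<^esub>], []) \<in> word_cong ?A ?R" by (simp add: InrI)
    from word_cong.trans[OF * this] show ?thesis
      using 2 H.inv_closed[of y] by (blast intro: InrI)
  qed
qed

lemma free_product_inl_hom: "free_product_inl G H \<in> hom G (free_product G H)" if "group G"
proof (rule homI)
  interpret G: group G by fact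
  let ?A = "carrier G <+> carrier H" and ?R = "free_product_rels G H"
  fix x y assume xy: "x \<in> carrier G" "y \<in> carrier G"
  then show "free_product_inl G H x \<in> carrier (free_product G H)"
    by (simp add: free_product_inl_def free_product_def word_class_carrier InlI)
  have "([Inl x, Inl y], [Inl (x \<otimes>\<^bsub>G\<^esub> y)]) \<in> ?R"
    unfolding free_product_rels_def using xy by blast
  from word_cong.rel[OF this, of ?A "[]" "[]"]
  have "([Inl x, Inl y], [Inl (x \<otimes>\<^bsub>G\<^esub> y)]) \<in> word_cong ?A ?R" using xy by (simp add: InlI InrI)
  then have "word_class ?A ?R [Inl x, Inl y] = word_class ?A ?R [Inl (x \<otimes>\<^bsub>G\<^esub> y)]"
    by (rule equiv_class_eq[OF equiv_word_cong])
  then show "free_product_inl G H (x \<otimes>\<^bsub>G\<^esub> y) =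
      free_product_inl G H x \<otimes>\<^bsub>free_product G H\<^esub> free_product_inl G H y"
    using xy by (simp add: free_product_inl_def free_product_def presented_monoid_mult InlI InrI)
qed

lemma free_product_inr_hom: "free_product_inr G H \<in> hom H (free_product G H)" if "group H"
proof (rule homI)
  interpret H: group H by fact
  let ?A = "carrier G <+> carrier H" and ?R = "free_product_rels G H"
  fix x y assume xy: "x \<in> carrier H" "y \<in> carrier H"
  then show "free_product_inr G H x \<in> carrier (free_product G H)"
    by (simp add: free_product_inr_def free_product_def word_class_carrier InrI)
  have "([Inr x, Inr y], [Inr (x \<otimes>\<^bsub>H\<^esub> y)]) \<in> ?R"
    unfolding free_product_rels_def using xy by blast
  from word_cong.rel[OF this, of ?A "[]" "[]"]
  have "([Inr x, Inr y], [Inr (x \<otimes>\<^bsub>H\<^esub> y)]) \<in> word_cong ?A ?R" using xy by (simp add: InlI InrI)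
  then have "word_class ?A ?R [Inr x, Inr y] = word_class ?A ?R [Inr (x \<otimes>\<^bsub>H\<^esub> y)]"
    by (rule equiv_class_eq[OF equiv_word_cong])
  then show "free_product_inr G H (x \<otimes>\<^bsub>H\<^esub> y) =
      free_product_inr G H x \<otimes>\<^bsub>free_product G H\<^esub> free_product_inr G H y"
    using xy by (simp add: free_product_inr_def free_product_def presented_monoid_mult InlI InrI)
qed

lemma free_product_universal:
  assumes "group G" "group H" "group K" "\<alpha> \<in> hom G K" "\<beta> \<in> hom H K"
  obtains h where "h \<in> hom (free_product G H) K"
    "\<And>x. x \<in> carrier G \<Longrightarrow> h (free_product_inl G H x) = \<alpha> x"
    "\<And>y. y \<in> carrier H \<Longrightarrow> h (free_product_inr G H y) = \<beta> y"
proof -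
  interpret K: group K by fact
  interpret \<alpha>: group_hom G K \<alpha> using assms by (simp add: group_hom_def group_hom_axioms_def)
  interpret \<beta>: group_hom H K \<beta> using assms by (simp add: group_hom_def group_hom_axioms_def)
  have f: "case_sum \<alpha> \<beta> \<in> carrier G <+> carrier H \<rightarrow> carrier K"
    by (rule funcsetI) (auto elim!: PlusE)
  obtain h where h: "h \<in> hom (free_product G H) K"
    "\<And>w. w \<in> lists (carrier G <+> carrier H) \<Longrightarrow>
      h (word_class (carrier G <+> carrier H) (free_product_rels G H) w) = K.word_eval (case_sum \<alpha> \<beta>) w"
    unfolding free_product_def
  proof (rule K.presented_monoid_universal[OF f])
    show "K.word_eval (case_sum \<alpha> \<beta>) u = K.word_eval (case_sum \<alpha> \<beta>) v"
      if "(u, v) \<in> free_product_rels G H" for u v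
      using that unfolding free_product_rels_def by auto
  qed blast
  show thesis
  proof (rule that[OF h(1)])
    show "h (free_product_inl G H x) = \<alpha> x" if "x \<in> carrier G" for x
      unfolding free_product_inl_def using that by (subst h(2)) (simp_all add: InlI)
    show "h (free_product_inr G H y) = \<beta> y" if "y \<in> carrier H" for y
      unfolding free_product_inr_def using that by (subst h(2)) (simp_all add: InrI)
  qed
qed

end

theory Submission
  imports Defs "HOL-Algebra.Generated_Groups"
begin

text \<open>
  A nontrivial mixed word can be rewritten as a reduced word \<open>g\<^sub>0 x\<^sub>1 g\<^sub>1 \<dots> x\<^sub>k g\<^sub>k\<close>, where each \<open>x\<^sub>j\<close> is a
  variable or an inverse of one. Topological freeness and the absence of isolated points give
  non-empty open sets, one for each letter and a further one for the starting point, that are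
  disjoint from each other and from the relevant translates by the finitely many coefficients.
  By extreme proximality each variable can be sent to an element \<open>a\<close> that maps the complement of the
  set of \<open>a\<^bsup>-1\<^esup>\<close> into the set of \<open>a\<close>; playing ping-pong, the word moves the starting point. With two
  variables and trivial coefficients the same argument yields a free subgroup of rank two.
\<close>

section \<open>Generators of presented groups\<close>

text \<open>The class of a word is the product of the classes of its letters.\<close>

lemma presented_monoid_carrier_subset:
  assumes N: "subgroup N (presented_monoid A R)"
    and gen: "\<And>a. a \<in> A \<Longrightarrow> word_class A R [a] \<in> N"
  shows "carrier (presented_monoid A R) \<subseteq> N"
proof
  fix X assume "X \<in> carrier (presented_monoid A R)"
  then obtain w where w: "w \<in> lists A" and X: "X = word_class A R w"
    by (rule presented_monoid_carrierE)
  from w have "word_class A R w \<in> N"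
  proof (induction w)
    case Nil
    show ?case
      using subgroup.one_closed[OF N] by (simp add: presented_monoid_one)
  next
    case (Cons a w)
    then have "word_class A R [a] \<otimes>\<^bsub>presented_monoid A R\<^esub> word_class A R w \<in> N"
      using subgroup.m_closed[OF N gen] by blast
    then show ?case
      using Cons.hyps by (subst (asm) presented_monoid_mult) auto
  qed
  then show "X \<in> N" by (simp add: X)
qed

lemma free_group_gen_closed: "s \<in> S \<Longrightarrow> free_group_gen S s \<in> carrier (free_group S)"
  by (simp add: free_group_gen_def free_group_def word_class_carrier)

text \<open>Free groups are presented as monoids, so a formal inverse is a letter of its own.
  Identifying it with the true inverse lets a subgroup be tested on the positive generators
  alone.\<close>

lemma free_group_inv_gen:
  assumes s: "s \<in> S"
  shows "inv\<^bsub>free_group S\<^esub> free_group_gen S s = word_class (S \<times> UNIV) (free_group_rels S) [(s, False)]"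
proof (rule group.inv_equality[OF group_free_group])
  let ?A = "S \<times> (UNIV :: bool set)" and ?R = "free_group_rels S"
  have "([(s, False), (s, True)], []) \<in> ?R"
    using s by (force simp: free_group_rels_def)
  from word_cong.rel[OF this, of ?A "[]" "[]"]
  have "([(s, False), (s, True)], []) \<in> word_cong ?A ?R"
    using s by simp
  then have "word_class ?A ?R [(s, False), (s, True)] = word_class ?A ?R []"
    by (rule equiv_class_eq[OF equiv_word_cong])
  then show "word_class ?A ?R [(s, False)] \<otimes>\<^bsub>free_group S\<^esub> free_group_gen S s = \<one>\<^bsub>free_group S\<^esub>"
    using s by (simp add: free_group_gen_def free_group_def presented_monoid_mult presented_monoid_one)
  show "word_class ?A ?R [(s, False)] \<in> carrier (free_group S)"
    using s by (simp add: free_group_def word_class_carrier)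
qed (simp add: free_group_gen_closed s)

lemma free_group_carrier_subset:
  assumes N: "subgroup N (free_group S)" and gen: "free_group_gen S ` S \<subseteq> N"
  shows "carrier (free_group S) \<subseteq> N"
  unfolding free_group_def
proof (rule presented_monoid_carrier_subset)
  show "subgroup N (presented_monoid (S \<times> UNIV) (free_group_rels S))"
    using N by (simp add: free_group_def)
  fix a :: "'a \<times> bool" assume "a \<in> S \<times> UNIV"
  then obtain s b where a: "a = (s, b)" "s \<in> S" by blast
  then have s: "free_group_gen S s \<in> N" using gen by blast
  from subgroup.m_inv_closed[OF N this]
  show "word_class (S \<times> UNIV) (free_group_rels S) [a] \<in> N"
    using s a by (cases b) (simp_all add: free_group_inv_gen, simp add: free_group_gen_def)
qed

lemma free_product_carrier_subset:
  assumes N: "subgroup N (free_product G H)"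
    and "free_product_inl G H ` carrier G \<subseteq> N" "free_product_inr G H ` carrier H \<subseteq> N"
  shows "carrier (free_product G H) \<subseteq> N"
  unfolding free_product_def
  by (rule presented_monoid_carrier_subset)
    (use assms in \<open>auto simp: free_product_def free_product_inl_def free_product_inr_def\<close>)

section \<open>Reduced mixed words\<close>

text \<open>A word \<open>g\<^sub>0 x\<^sub>1 g\<^sub>1 \<dots> x\<^sub>k g\<^sub>k\<close> with letters \<open>x\<^sub>j\<close> and coefficients \<open>g\<^sub>j\<close> is encoded as the pair
  of \<open>g\<^sub>0\<close> and the list of the syllables \<open>(x\<^sub>j, g\<^sub>j)\<close>; letters follow the convention of \<^const>\<open>free_group\<close>.\<close>

definition flip :: "'i \<times> bool \<Rightarrow> 'i \<times> bool" where
  "flip p = (fst p, \<not> snd p)"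

text \<open>The coefficient \<open>snd x\<close> stands between the letters of two neighbouring
  syllables. It may be trivial between equal letters, and the last coefficient is
  unrestricted.\<close>

definition mixed_reduced :: "('g, 'm) monoid_scheme \<Rightarrow> (('i \<times> bool) \<times> 'g) list \<Rightarrow> bool" where
  "mixed_reduced G = successively (\<lambda>x y. fst y = flip (fst x) \<longrightarrow> snd x \<noteq> \<one>\<^bsub>G\<^esub>)"

definition letter :: "('k, 'n) monoid_scheme \<Rightarrow> ('i \<Rightarrow> 'k) \<Rightarrow> 'i \<times> bool \<Rightarrow> 'k" where
  "letter K b p = (if snd p then b (fst p) else inv\<^bsub>K\<^esub> b (fst p))"

text \<open>The leading coefficient \<open>g\<^sub>0\<close> is left out, so that the recursion goes
  syllable by syllable. With \<open>K\<close> and \<open>\<alpha>\<close> variable, one word is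
  evaluated both formally, in a free product or free group, and concretely in
  \<open>G\<close>.\<close>

primrec mixed_eval ::
    "('k, 'n) monoid_scheme \<Rightarrow> ('g \<Rightarrow> 'k) \<Rightarrow> ('i \<Rightarrow> 'k) \<Rightarrow> (('i \<times> bool) \<times> 'g) list \<Rightarrow> 'k" where
  "mixed_eval K \<alpha> b [] = \<one>\<^bsub>K\<^esub>"
| "mixed_eval K \<alpha> b (x # L) =
     letter K b (fst x) \<otimes>\<^bsub>K\<^esub> (\<alpha> (snd x) \<otimes>\<^bsub>K\<^esub> mixed_eval K \<alpha> b L)"

abbreviation mixed_words :: "'i set \<Rightarrow> 'g set \<Rightarrow> (('i \<times> bool) \<times> 'g) list set" where
  "mixed_words I C \<equiv> lists ((I \<times> UNIV) \<times> C)"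

lemma (in group) letter_closed: "b \<in> I \<rightarrow> carrier G \<Longrightarrow> p \<in> I \<times> UNIV \<Longrightarrow> letter G b p \<in> carrier G"
  by (auto simp: letter_def Pi_iff)

lemma (in group) letter_flip:
  assumes "b \<in> I \<rightarrow> carrier G" "p \<in> I \<times> UNIV"
  shows "letter G b (flip p) = inv letter G b p"
  using assms by (auto simp: letter_def flip_def Pi_iff)

lemma (in group) mixed_eval_closed:
  assumes "b \<in> I \<rightarrow> carrier G" "\<alpha> \<in> C \<rightarrow> carrier G" "L \<in> mixed_words I C"
  shows "mixed_eval G \<alpha> b L \<in> carrier G"
  using assms(3)
proof (induction L)
  case (Cons x L)
  then show ?case
    using letter_closed[OF assms(1)] assms(2) by (auto simp: Pi_iff)
qed simp

lemma (in group_hom) hom_mixed_eval: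
  assumes b: "b \<in> I \<rightarrow> carrier G" and \<alpha>: "\<alpha> \<in> C \<rightarrow> carrier G" and L: "L \<in> mixed_words I C"
    and "\<And>i. i \<in> I \<Longrightarrow> h (b i) = b' i" "\<And>c. c \<in> C \<Longrightarrow> h (\<alpha> c) = \<alpha>' c"
  shows "h (mixed_eval G \<alpha> b L) = mixed_eval H \<alpha>' b' L"
  using L
proof (induction L)
  case (Cons x L)
  have "h (letter G b (fst x)) = letter H b' (fst x)"
    using Cons.hyps assms by (auto simp: letter_def Pi_iff)
  moreover have "mixed_eval G \<alpha> b L \<in> carrier G"
    by (rule G.mixed_eval_closed[OF b \<alpha> Cons.hyps(2)])
  moreover have "letter G b (fst x) \<in> carrier G" "\<alpha> (snd x) \<in> carrier G"
    using Cons.hyps G.letter_closed[OF b] \<alpha> by auto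
  ultimately show ?case
    using Cons assms(5) by auto
qed simp

text \<open>The elements with a reduced form are closed under left multiplication by coefficients
  and by letters, and they include the identity.\<close>

lemma reduced_mixed_form:
  assumes "group_hom G K \<alpha>" and b: "b \<in> I \<rightarrow> carrier K"
    and k: "k \<in> generate K (\<alpha> ` carrier G \<union> b ` I)"
  obtains g L where "g \<in> carrier G" "L \<in> mixed_words I (carrier G)" "mixed_reduced G L"
    "k = \<alpha> g \<otimes>\<^bsub>K\<^esub> mixed_eval K \<alpha> b L"
proof -
  interpret group_hom G K \<alpha> by fact
  define N where "N = {\<alpha> g \<otimes>\<^bsub>K\<^esub> mixed_eval K \<alpha> b L | g L.
    g \<in> carrier G \<and> L \<in> mixed_words I (carrier G) \<and> mixed_reduced G L}"
  have \<alpha>: "\<alpha> \<in> carrier G \<rightarrow> carrier K" by auto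
  note ev = H.mixed_eval_closed[OF b \<alpha>]
  have N: "N \<subseteq> carrier K" unfolding N_def by (blast intro: H.m_closed hom_closed ev)
  have gens: "\<alpha> ` carrier G \<union> b ` I \<subseteq> carrier K"
    using b by auto
  have coeff: "\<alpha> c \<otimes>\<^bsub>K\<^esub> x \<in> N" if c: "c \<in> carrier G" and x: "x \<in> N" for c x
  proof -
    obtain g L where gL: "g \<in> carrier G" "L \<in> mixed_words I (carrier G)" "mixed_reduced G L"
      "x = \<alpha> g \<otimes>\<^bsub>K\<^esub> mixed_eval K \<alpha> b L" using x unfolding N_def by blast
    have "\<alpha> c \<otimes>\<^bsub>K\<^esub> x = \<alpha> (c \<otimes>\<^bsub>G\<^esub> g) \<otimes>\<^bsub>K\<^esub> mixed_eval K \<alpha> b L"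
      using c gL ev[OF gL(2)] by (simp add: H.m_assoc)
    then show ?thesis using c gL unfolding N_def by blast
  qed
  have var: "letter K b p \<otimes>\<^bsub>K\<^esub> x \<in> N" if p: "p \<in> I \<times> UNIV" and x: "x \<in> N" for p x
  proof -
    obtain g L where gL: "g \<in> carrier G" "L \<in> mixed_words I (carrier G)" "mixed_reduced G L"
      "x = \<alpha> g \<otimes>\<^bsub>K\<^esub> mixed_eval K \<alpha> b L" using x unfolding N_def by blast
    note p' = H.letter_closed[OF b p]
    show ?thesis
    \<comment> \<open>Prefixing \<open>p\<close> spoils reducedness only when a trivial leading
      coefficient is followed by the letter inverse to \<open>p\<close>. The two letters then cancel
      and \<open>c\<close> becomes the new leading coefficient.\<close>
    proof (cases "\<exists>c L'. L = (flip p, c) # L' \<and> g = \<one>\<^bsub>G\<^esub>")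
      case True
      then obtain c L' where L: "L = (flip p, c) # L'" and g: "g = \<one>\<^bsub>G\<^esub>" by blast
      have c: "c \<in> carrier G" and L': "L' \<in> mixed_words I (carrier G)" "mixed_reduced G L'"
        using gL by (auto simp: L mixed_reduced_def successively_Cons)
      note ev' = ev[OF L'(1)]
      have "letter K b p \<otimes>\<^bsub>K\<^esub> x = letter K b p \<otimes>\<^bsub>K\<^esub> (inv\<^bsub>K\<^esub> letter K b p \<otimes>\<^bsub>K\<^esub> (\<alpha> c \<otimes>\<^bsub>K\<^esub> mixed_eval K \<alpha> b L'))"
        using ev' c p' by (simp add: gL(4) L g H.letter_flip[OF b p])
      also have "\<dots> = \<alpha> c \<otimes>\<^bsub>K\<^esub> mixed_eval K \<alpha> b L'"
        using ev' c p' by (simp add: H.m_assoc[symmetric])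
      finally show ?thesis using c L' unfolding N_def by blast
    next
      case False
      then have "mixed_reduced G ((p, g) # L)"
        using gL(3) by (cases L) (auto simp: mixed_reduced_def)
      moreover have "letter K b p \<otimes>\<^bsub>K\<^esub> x = \<alpha> \<one>\<^bsub>G\<^esub> \<otimes>\<^bsub>K\<^esub> mixed_eval K \<alpha> b ((p, g) # L)"
        using gL p' ev[OF gL(2)] by simp
      moreover have "(p, g) # L \<in> mixed_words I (carrier G)" using p gL by auto
      ultimately show ?thesis unfolding N_def by blast
    qed
  qed
  \<comment> \<open>In the form that \<open>k\<close> maps \<open>N\<close> into itself, the claim
    composes along products. Applying it to the identity gives \<open>k \<in> N\<close>.\<close>
  have "k \<otimes>\<^bsub>K\<^esub> x \<in> N" if "x \<in> N" for x
    using k that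
  proof (induction arbitrary: x)
    case one
    then show ?case using N by auto
  next
    case (incl y)
    then show ?case using coeff var[of "(_, True)"] by (auto simp: letter_def)
  next
    case (inv y)
    then consider c where "c \<in> carrier G" "y = \<alpha> c" | i where "i \<in> I" "y = b i" by blast
    then show ?case
    proof cases
      case 1
      then have "inv\<^bsub>K\<^esub> y = \<alpha> (inv\<^bsub>G\<^esub> c)" by simp
      with coeff[of "inv\<^bsub>G\<^esub> c"] 1(1) inv.prems show ?thesis by simp
    next
      case 2
      then show ?thesis using var[of "(i, False)"] inv.prems by (simp add: letter_def)
    qed
  next
    case (eng y z)
    have "y \<in> carrier K" "z \<in> carrier K" "x \<in> carrier K"
      using H.generate_in_carrier[OF gens] eng.hyps eng.prems N by blast+
    then have "y \<otimes>\<^bsub>K\<^esub> z \<otimes>\<^bsub>K\<^esub> x = y \<otimes>\<^bsub>K\<^esub> (z \<otimes>\<^bsub>K\<^esub> x)" by (rule H.m_assoc)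
    then show ?case using eng by simp
  qed
  moreover have "\<alpha> \<one>\<^bsub>G\<^esub> \<otimes>\<^bsub>K\<^esub> mixed_eval K \<alpha> b [] \<in> N"
    unfolding N_def mixed_reduced_def by fastforce
  ultimately have "k \<otimes>\<^bsub>K\<^esub> (\<alpha> \<one>\<^bsub>G\<^esub> \<otimes>\<^bsub>K\<^esub> mixed_eval K \<alpha> b []) \<in> N" by blast
  moreover have "k \<in> carrier K"
    by (rule H.generate_in_carrier[OF gens k])
  ultimately have "k \<in> N" by simp
  then show thesis using that unfolding N_def by blast
qed

section \<open>Extremely proximal actions\<close>

text \<open>A finite Baire argument: the closures are removed one at a time, and since none has
  interior, a non-empty open set remains after each removal.\<close>

lemma nowhere_dense_in_avoid:
  assumes "finite T" "\<And>S. S \<in> T \<Longrightarrow> nowhere_dense_in X S" "openin X U" "U \<noteq> {}"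
  obtains x where "x \<in> U" "x \<notin> \<Union>T"
proof -
  from assms have "\<exists>V. openin X V \<and> V \<noteq> {} \<and> V \<subseteq> U - \<Union>T"
  proof (induction T)
    case empty
    then show ?case by auto
  next
    case (insert S T)
    then obtain V where V: "openin X V" "V \<noteq> {}" "V \<subseteq> U - \<Union>T" by auto
    have S: "S \<subseteq> topspace X" "X interior_of (X closure_of S) = {}"
      using insert.prems(1)[of S] by (auto simp: nowhere_dense_in_def)
    then have "\<not> V \<subseteq> X closure_of S"
      using interior_of_maximal[OF _ V(1)] V(2) by blast
    moreover have "openin X (V - X closure_of S)"
      using V(1) by (simp add: openin_diff)
    moreover have "S \<subseteq> X closure_of S"
      using S(1) by (rule closure_of_subset)
    ultimately show ?case
      using V(3) by (intro exI[of _ "V - X closure_of S"]) blast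
  qed
  then show thesis using that by blast
qed

locale ep_action = group_action G "topspace X" \<phi>
  for G :: "('g, 'm) monoid_scheme" (structure) and X :: "'x topology" and \<phi> +
  assumes hausdorff: "Hausdorff_space X"
    and large: "infinite (topspace X) \<or> card (topspace X) > 2"
    and continuous: "g \<in> carrier G \<Longrightarrow> continuous_map X X (\<phi> g)"
    and free: "topologically_free G X \<phi>"
    and proximal: "extremely_proximal G X \<phi>"
begin

sublocale group G
  using group_hom by (simp add: group_hom_def)

lemma action_one: "x \<in> topspace X \<Longrightarrow> \<phi> \<one> x = x"
  using id_eq_one by (metis restrict_apply')

lemma action_closed: "g \<in> carrier G \<Longrightarrow> x \<in> topspace X \<Longrightarrow> \<phi> g x \<in> topspace X"
  using element_image by blast

section \<open>Isolated points and points in general position\<close>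

text \<open>Taking \<open>{x}\<close> for both open sets, extreme proximality gives an element
  injecting the complement of \<open>x\<close> into one point. The space would then have at most two
  points.\<close>

lemma not_openin_singleton: "\<not> openin X {x}"
proof
  assume x: "openin X {x}"
  obtain g where g: "g \<in> carrier G" "\<phi> g ` (topspace X - {x}) \<subseteq> {x}"
    using proximal x unfolding extremely_proximal_def by blast
  have "finite (topspace X - {x}) \<and> card (topspace X - {x}) \<le> card {x}"
  proof -
    have "inj_on (\<phi> g) (topspace X - {x})"
      using inj_prop[OF g(1)] by (rule inj_on_subset) blast
    then show ?thesis
      using g(2) by (meson card_inj_on_le finite.emptyI finite_insert inj_on_finite)
  qed
  then show False
    using large openin_subset[OF x] by (auto simp: card_Diff_singleton_if)
qed

text \<open>Points of a Hausdorff space are closed, and here none is isolated.\<close>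

lemma nowhere_dense_singleton: "x \<in> topspace X \<Longrightarrow> nowhere_dense_in X {x}"
proof -
  assume x: "x \<in> topspace X"
  have "X interior_of {x} \<noteq> {x}"
    using not_openin_singleton[of x] by (metis openin_interior_of)
  then have "X interior_of {x} = {}"
    using interior_of_subset[of X "{x}"] by blast
  moreover have "X closure_of {x} = {x}"
    using hausdorff x by (simp add: closure_of_closedin closedin_Hausdorff_sing_eq)
  ultimately show ?thesis using x by (simp add: nowhere_dense_in_def)
qed

text \<open>Genericity amounts to avoiding finitely many nowhere dense sets: the fixed points of the \<open>c \<noteq> \<one>\<close>
  and, as points are nowhere dense, the translates of the points chosen before.\<close>

lemma generic_points:
  assumes "finite P" "finite C" "C \<subseteq> carrier G"
  obtains z where "z \<in> P \<rightarrow> topspace X"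
    "\<And>p q c. p \<in> P \<Longrightarrow> q \<in> P \<Longrightarrow> c \<in> C \<Longrightarrow> p \<noteq> q \<or> c \<noteq> \<one> \<Longrightarrow> \<phi> c (z p) \<noteq> z q"
proof -
  from assms(1) have "\<exists>z\<in>P \<rightarrow> topspace X. \<forall>p\<in>P. \<forall>q\<in>P. \<forall>c\<in>C. p \<noteq> q \<or> c \<noteq> \<one> \<longrightarrow> \<phi> c (z p) \<noteq> z q"
    (is "\<exists>z\<in>_. ?generic z")
  proof (induction P)
    case empty
    then show ?case by auto
  next
    case (insert p P)
    then obtain z where z: "z \<in> P \<rightarrow> topspace X"
      "\<forall>p\<in>P. \<forall>q\<in>P. \<forall>c\<in>C. p \<noteq> q \<or> c \<noteq> \<one> \<longrightarrow> \<phi> c (z p) \<noteq> z q" by (elim bexE)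
    \<comment> \<open>The three families exclude in turn \<open>\<phi> c x = x\<close>,
      \<open>\<phi> c (z q) = x\<close> and \<open>\<phi> c x = z q\<close>; the last is rewritten
      as \<open>x = \<phi> (inv c) (z q)\<close> to be a condition on \<open>x\<close>.\<close>
    define T where "T = invariants (topspace X) \<phi> ` (C - {\<one>}) \<union>
      (\<lambda>(c, q). {\<phi> c (z q)}) ` (C \<times> P) \<union> (\<lambda>(c, q). {\<phi> (inv c) (z q)}) ` (C \<times> P)"
    have "nowhere_dense_in X S" if "S \<in> T" for S
      using that free assms(3) z(1) unfolding T_def topologically_free_def
      by (auto intro!: nowhere_dense_singleton action_closed dest: funcset_mem)
    moreover have "finite T"
      using insert.hyps assms(2) by (simp add: T_def)
    moreover have "topspace X \<noteq> {}"
      using large by auto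
    ultimately obtain x where x: "x \<in> topspace X" "x \<notin> \<Union>T"
      using nowhere_dense_in_avoid[of T X "topspace X"] by blast
    have fixed: "\<phi> c x \<noteq> x" if "c \<in> C" "c \<noteq> \<one>" for c
      using x that by (auto simp: T_def invariants_def)
    have other: "\<phi> c (z q) \<noteq> x" "\<phi> c x \<noteq> z q" if "c \<in> C" "q \<in> P" for c q
    proof -
      show "\<phi> c (z q) \<noteq> x" using x that by (auto simp: T_def)
      have "\<phi> (inv c) (z q) \<noteq> x" using x that by (auto simp: T_def)
      then show "\<phi> c x \<noteq> z q"
        using orbit_sym_aux[of c x "z q"] that x(1) assms(3) by blast
    qed
    show ?case
      using insert.hyps z x(1) fixed other by (intro bexI[of _ "z(p := x)"]) auto
  qed
  then obtain z where "z \<in> P \<rightarrow> topspace X" "?generic z" by (elim bexE)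
  then show thesis by (intro that[of z]) auto
qed

section \<open>Open sets in general position\<close>

lemma separating_neighbourhoods:
  assumes "c \<in> carrier G" "x \<in> topspace X" "y \<in> topspace X" "\<phi> c x \<noteq> y"
  obtains A B where "openin X A" "openin X B" "x \<in> A" "y \<in> B" "\<phi> c ` A \<inter> B = {}"
proof -
  have "\<phi> c x \<in> topspace X" using assms action_closed by blast
  then obtain V B where VB: "openin X V" "openin X B" "\<phi> c x \<in> V" "y \<in> B" "disjnt V B"
    using hausdorff assms unfolding Hausdorff_space_def by blast
  have "openin X {x \<in> topspace X. \<phi> c x \<in> V}"
    using continuous[OF assms(1)] VB(1) by (simp add: continuous_map_def)
  then show thesis
    by (rule that[OF _ VB(2) _ VB(4)]) (use assms VB in \<open>auto simp: disjnt_def\<close>)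
qed

text \<open>Neighbourhoods of generic points are shrunk once for each of the finitely many
  conditions; shrinking preserves the conditions already secured.\<close>

lemma generic_open_sets:
  assumes "finite P" "finite C" "C \<subseteq> carrier G"
  obtains U where "\<And>p. p \<in> P \<Longrightarrow> openin X (U p)" "\<And>p. p \<in> P \<Longrightarrow> U p \<noteq> {}"
    "\<And>p q c. p \<in> P \<Longrightarrow> q \<in> P \<Longrightarrow> c \<in> C \<Longrightarrow> p \<noteq> q \<or> c \<noteq> \<one> \<Longrightarrow> \<phi> c ` U p \<inter> U q = {}"
proof -
  obtain z where z: "z \<in> P \<rightarrow> topspace X"
    "\<And>p q c. p \<in> P \<Longrightarrow> q \<in> P \<Longrightarrow> c \<in> C \<Longrightarrow> p \<noteq> q \<or> c \<noteq> \<one> \<Longrightarrow> \<phi> c (z p) \<noteq> z q"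
    using generic_points[OF assms] by metis
  define T where "T = {(p, q, c) \<in> P \<times> P \<times> C. p \<noteq> q \<or> c \<noteq> \<one>}"
  have "finite T"
    by (rule finite_subset[of _ "P \<times> P \<times> C"]) (use assms in \<open>auto simp: T_def\<close>)
  moreover have "T \<subseteq> T" ..
  ultimately have "\<exists>U. (\<forall>p\<in>P. openin X (U p) \<and> z p \<in> U p) \<and> (\<forall>(p, q, c)\<in>T. \<phi> c ` U p \<inter> U q = {})"
  proof (induction rule: finite_subset_induct)
    case empty
    then show ?case using z(1) by (intro exI[of _ "\<lambda>_. topspace X"]) auto
  next
    case (insert t F)
    obtain p q c where t: "t = (p, q, c)" by (cases t)
    obtain U where U: "\<forall>p\<in>P. openin X (U p) \<and> z p \<in> U p" "\<forall>(p, q, c)\<in>F. \<phi> c ` U p \<inter> U q = {}"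
      using insert.IH by blast
    have "c \<in> carrier G" "z p \<in> topspace X" "z q \<in> topspace X" "\<phi> c (z p) \<noteq> z q"
      using insert.hyps(2) t z assms(3) by (auto simp: T_def)
    then obtain A B where AB: "openin X A" "openin X B" "z p \<in> A" "z q \<in> B" "\<phi> c ` A \<inter> B = {}"
      by (rule separating_neighbourhoods)
    \<comment> \<open>The two tests are separate so that for \<open>p = q\<close> the set is cut by
      both \<open>A\<close> and \<open>B\<close>.\<close>
    define U' where "U' r = U r \<inter> (if r = p then A else topspace X) \<inter> (if r = q then B else topspace X)" for r
    have "\<forall>r\<in>P. openin X (U' r) \<and> z r \<in> U' r"
      using U(1) AB z(1) by (auto simp: U'_def)
    moreover have "U' r \<subseteq> U r" for r by (auto simp: U'_def)
    then have "\<forall>(p, q, c)\<in>F. \<phi> c ` U' p \<inter> U' q = {}"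
      using U(2) by (simp add: case_prod_unfold) (meson disjoint_iff image_mono subset_iff)
    moreover have "\<phi> c ` U' p \<inter> U' q = {}"
      using AB(5) by (auto simp: U'_def)
    ultimately show ?case by (intro exI[of _ U']) (simp add: t)
  qed
  then obtain U where U: "\<forall>p\<in>P. openin X (U p) \<and> z p \<in> U p"
    and disj: "\<forall>(p, q, c)\<in>T. \<phi> c ` U p \<inter> U q = {}" by (elim exE conjE)
  show thesis
  proof (rule that[of U])
    show "\<phi> c ` U p \<inter> U q = {}" if "p \<in> P" "q \<in> P" "c \<in> C" "p \<noteq> q \<or> c \<noteq> \<one>" for p q c
      using bspec[OF disj, of "(p, q, c)"] that by (simp add: T_def)
  qed (use U in auto)
qed

section \<open>Ping-pong for mixed words\<close>

text \<open>The choice of \<open>a\<close> depends only on \<open>I\<close> and \<open>C\<close>, so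
  it serves all reduced words with coefficients in \<open>C\<close> at once; the free subgroup
  requires this uniformity.\<close>

lemma ping_pong:
  fixes I :: "'i set"
  assumes I: "finite I" and C: "finite C" "C \<subseteq> carrier G"
  obtains a where "a \<in> I \<rightarrow> carrier G"
    "\<And>g L. g \<in> C \<Longrightarrow> L \<in> mixed_words I C \<Longrightarrow> mixed_reduced G L \<Longrightarrow> L = [] \<longrightarrow> g \<noteq> \<one> \<Longrightarrow>
      g \<otimes> mixed_eval G (\<lambda>c. c) a L \<noteq> \<one>"
proof -
  \<comment> \<open>\<open>Some p\<close> indexes the target of the letter \<open>p\<close>, and \<open>None\<close> a set around the starting point.\<close>
  define P where "P = insert None (Some ` (I \<times> (UNIV :: bool set)))"
  have P: "finite P" using I by (simp add: P_def)
  obtain U where U: "\<And>p. p \<in> P \<Longrightarrow> openin X (U p)" "\<And>p. p \<in> P \<Longrightarrow> U p \<noteq> {}"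
    and disj: "\<And>p q c. p \<in> P \<Longrightarrow> q \<in> P \<Longrightarrow> c \<in> C \<Longrightarrow> p \<noteq> q \<or> c \<noteq> \<one> \<Longrightarrow> \<phi> c ` U p \<inter> U q = {}"
    using generic_open_sets[OF P C] by metis
  have "\<exists>g\<in>carrier G. \<phi> g ` (topspace X - U (Some (i, False))) \<subseteq> U (Some (i, True))" if "i \<in> I" for i
    using proximal U[of "Some (i, False)"] U[of "Some (i, True)"] that
    unfolding extremely_proximal_def by (simp add: P_def)
  then obtain a where a: "\<And>i. i \<in> I \<Longrightarrow> a i \<in> carrier G"
    "\<And>i. i \<in> I \<Longrightarrow> \<phi> (a i) ` (topspace X - U (Some (i, False))) \<subseteq> U (Some (i, True))"
    by metis
  then have aI: "a \<in> I \<rightarrow> carrier G" by blast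
  have push: "\<phi> (letter G a p) x \<in> U (Some p)"
    if p: "p \<in> I \<times> UNIV" and x: "x \<in> topspace X" "x \<notin> U (Some (flip p))" for p x
  proof -
    obtain i e where ie: "p = (i, e)" "i \<in> I" using p by blast
    show ?thesis
    proof (cases e)
      case True
      then show ?thesis using a(2)[OF ie(2)] x ie by (auto simp: letter_def flip_def)
    next
      case False
      \<comment> \<open>Were \<open>y\<close> outside the set of \<open>(i, False)\<close>, then
        \<open>a i\<close> would carry it into the set of \<open>(i, True)\<close>. But its image is
        \<open>x\<close>, which avoids that set.\<close>
      define y where "y = \<phi> (inv (a i)) x"
      have y: "y \<in> topspace X" "\<phi> (a i) y = x"
        using orbit_sym_aux[of "inv (a i)" x y] action_closed[of "inv (a i)" x] a(1)[OF ie(2)] x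
        by (auto simp: y_def)
      then have "y \<in> U (Some (i, False))"
        using a(2)[OF ie(2)] x ie False by (auto simp: flip_def)
      then show ?thesis using False ie by (simp add: letter_def y_def)
    qed
  qed
  obtain z where zU: "z \<in> U None" using U(2)[of None] by (auto simp: P_def)
  then have z: "z \<in> topspace X" using openin_subset[OF U(1)[of None]] by (auto simp: P_def)
  have CG: "(\<lambda>c. c) \<in> C \<rightarrow> carrier G" using C by auto
  note ev = mixed_eval_closed[OF aI CG]
  \<comment> \<open>Syllables act from right to left, so the position of the moved point is recorded
    by the leftmost letter.\<close>
  have play: "\<phi> (mixed_eval G (\<lambda>c. c) a L) z \<in> U (if L = [] then None else Some (fst (hd L)))"
    if "L \<in> mixed_words I C" "mixed_reduced G L" for L
    using that
  proof (induction L)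
    case Nil
    then show ?case using zU z by (simp add: action_one)
  next
    case (Cons s L)
    obtain p c where s: "s = (p, c)" by (cases s)
    let ?e = "mixed_eval G (\<lambda>c. c) a L" and ?q = "if L = [] then None else Some (fst (hd L))"
    have p: "p \<in> I \<times> UNIV" and c: "c \<in> C" "c \<in> carrier G" and L: "L \<in> mixed_words I C"
      using Cons.hyps s C by auto
    have "\<phi> ?e z \<in> U ?q"
      using Cons by (cases L) (auto simp: mixed_reduced_def)
    \<comment> \<open>This is where reducedness enters: \<open>c\<close> moves the current set off
      the one set from which \<open>p\<close> cannot push.\<close>
    moreover have "?q \<noteq> Some (flip p) \<or> c \<noteq> \<one>"
      using Cons.prems by (cases L) (auto simp: s mixed_reduced_def)
    then have "\<phi> c ` U ?q \<inter> U (Some (flip p)) = {}"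
    proof (intro disj)
      show "?q \<in> P" using L by (cases L) (auto simp: P_def)
    qed (use p c(1) in \<open>auto simp: P_def flip_def\<close>)
    ultimately have "\<phi> c (\<phi> ?e z) \<notin> U (Some (flip p))" by blast
    moreover have "\<phi> c (\<phi> ?e z) \<in> topspace X"
      by (intro action_closed c(2) z ev[OF L])
    ultimately have "\<phi> (letter G a p) (\<phi> c (\<phi> ?e z)) \<in> U (Some p)"
      by (intro push p)
    then show ?case
      using s composition_rule[of z] z ev[OF L] c(2) letter_closed[OF aI p] by simp
  qed
  show thesis
  proof (rule that[OF aI])
    fix g L assume g: "g \<in> C" and L: "L \<in> mixed_words I C" "mixed_reduced G L" "L = [] \<longrightarrow> g \<noteq> \<one>"
    let ?e = "mixed_eval G (\<lambda>c. c) a L" and ?q = "if L = [] then None else Some (fst (hd L))"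
    \<comment> \<open>For non-empty \<open>L\<close> the indices differ, so \<open>g\<close> may be
      trivial; for empty \<open>L\<close> both are \<open>None\<close>, and
      \<open>g \<noteq> \<one>\<close> is what separates.\<close>
    have "\<phi> g ` U ?q \<inter> U None = {}"
    proof (rule disj)
      show "?q \<in> P" using L(1) by (cases L) (auto simp: P_def)
    qed (use L(3) g in \<open>auto simp: P_def\<close>)
    moreover have "\<phi> g (\<phi> ?e z) \<in> \<phi> g ` U ?q"
      by (intro imageI play L)
    ultimately have "\<phi> g (\<phi> ?e z) \<noteq> z"
      using zU by (metis disjoint_iff)
    then have "\<phi> (g \<otimes> ?e) z \<noteq> \<phi> \<one> z"
      using composition_rule[of z g ?e] z subsetD[OF C(2) g] ev[OF L(1)] by (simp add: action_one)
    then show "g \<otimes> ?e \<noteq> \<one>" by auto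
  qed
qed

section \<open>Mixed identities and the free subgroup\<close>

text \<open>The universal properties turn the ping-pong elements into a homomorphism fixing
  \<open>G\<close>, which evaluates the reduced form of \<open>w\<close> to a nontrivial
  element.\<close>

lemma mixed_identity_free: "mixed_identity_free G"
  unfolding mixed_identity_free_def Let_def
proof (intro allI ballI impI)
  fix n :: nat and w
  let ?F = "free_group {..<n}"
  let ?P = "free_product G ?F"
  assume w: "w \<in> carrier ?P" "w \<noteq> \<one>\<^bsub>?P\<^esub>"
  let ?b = "\<lambda>i. free_product_inr G ?F (free_group_gen {..<n} i)"
  interpret F: group ?F by (rule group_free_group)
  interpret P: group ?P by (rule group_free_product) unfold_locales
  interpret l: group_hom G ?P "free_product_inl G ?F"
    by unfold_locales (rule free_product_inl_hom, unfold_locales)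
  interpret r: group_hom ?F ?P "free_product_inr G ?F"
    by unfold_locales (rule free_product_inr_hom, unfold_locales)
  have gens: "free_group_gen {..<n} ` {..<n} \<subseteq> carrier ?F"
    by (intro image_subsetI free_group_gen_closed)
  then have b: "?b \<in> {..<n} \<rightarrow> carrier ?P" by auto
  \<comment> \<open>This subgroup is the whole free product, which makes a reduced form available
    for \<open>w\<close>.\<close>
  define N where "N = generate ?P (free_product_inl G ?F ` carrier G \<union> ?b ` {..<n})"
  have sub: "subgroup N ?P"
    unfolding N_def using b by (intro P.generate_is_subgroup) auto
  have "free_product_inr G ?F ` generate ?F (free_group_gen {..<n} ` {..<n}) \<subseteq> N"
    unfolding r.generate_img[OF gens, symmetric] N_def
    by (rule P.mono_generate) auto
  moreover have "carrier ?F \<subseteq> generate ?F (free_group_gen {..<n} ` {..<n})"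
    by (rule free_group_carrier_subset[OF F.generate_is_subgroup[OF gens]]) (blast intro: generate.incl)
  ultimately have "free_product_inr G ?F ` carrier ?F \<subseteq> N"
    by (meson image_mono order_trans)
  moreover have "free_product_inl G ?F ` carrier G \<subseteq> N"
    unfolding N_def by (blast intro: generate.incl)
  ultimately have "w \<in> N"
    using free_product_carrier_subset[OF sub] w(1) by blast
  then obtain g L where g: "g \<in> carrier G" and L: "L \<in> mixed_words {..<n} (carrier G)" "mixed_reduced G L"
    and w_eq: "w = free_product_inl G ?F g \<otimes>\<^bsub>?P\<^esub> mixed_eval ?P (free_product_inl G ?F) ?b L"
    unfolding N_def by (rule reduced_mixed_form[OF l.group_hom_axioms b])
  \<comment> \<open>Only the finitely many coefficients of \<open>w\<close> matter, so the
    homomorphism may depend on \<open>w\<close>.\<close>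
  define C where "C = insert g (snd ` set L)"
  have "finite C" "C \<subseteq> carrier G"
    using g L(1) by (auto simp: C_def)
  from ping_pong[OF finite_lessThan[of n] this] obtain a where a: "a \<in> {..<n} \<rightarrow> carrier G"
    "\<And>g L. g \<in> C \<Longrightarrow> L \<in> mixed_words {..<n} C \<Longrightarrow> mixed_reduced G L \<Longrightarrow> L = [] \<longrightarrow> g \<noteq> \<one> \<Longrightarrow>
      g \<otimes> mixed_eval G (\<lambda>c. c) a L \<noteq> \<one>" by metis
  obtain \<beta> where \<beta>: "\<beta> \<in> hom ?F G" "\<And>i. i \<in> {..<n} \<Longrightarrow> \<beta> (free_group_gen {..<n} i) = a i"
    using free_group_universal[OF is_group a(1)] by metis
  have "(\<lambda>x. x) \<in> hom G G" by (simp add: hom_def)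
  from free_product_universal[OF is_group group_free_group is_group this \<beta>(1)]
  obtain h where h: "h \<in> hom ?P G"
    "\<And>x. x \<in> carrier G \<Longrightarrow> h (free_product_inl G ?F x) = x"
    "\<And>y. y \<in> carrier ?F \<Longrightarrow> h (free_product_inr G ?F y) = \<beta> y" by metis
  interpret h: group_hom ?P G h
    by unfold_locales (rule h)
  have \<alpha>: "free_product_inl G ?F \<in> carrier G \<rightarrow> carrier ?P" by auto
  have "h w = g \<otimes> mixed_eval G (\<lambda>c. c) a L"
    using h.hom_mixed_eval[OF b \<alpha> L(1), of a "\<lambda>c. c"] P.mixed_eval_closed[OF b \<alpha> L(1)] g
    by (simp add: w_eq h \<beta> free_group_gen_closed)
  also have "\<dots> \<noteq> \<one>"
  proof (rule a(2))
    show "g \<in> C" "mixed_reduced G L"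
      using L by (simp_all add: C_def)
    show "L \<in> mixed_words {..<n} C"
      using L(1) by (force simp: C_def)
    show "L = [] \<longrightarrow> g \<noteq> \<one>" using w(2) by (auto simp: w_eq)
  qed
  finally show "\<exists>h\<in>hom ?P G. (\<forall>g\<in>carrier G. h (free_product_inl G ?F g) = g) \<and> h w \<noteq> \<one>"
    using h by blast
qed

text \<open>Ping-pong with two variables and trivial coefficients makes the map from the free group
  on the two chosen elements injective; its image is the required subgroup.\<close>

lemma contains_free_subgroup:
  "\<exists>H. subgroup H G \<and> is_free_group (G\<lparr>carrier := H\<rparr>) \<and> \<not> comm_group (G\<lparr>carrier := H\<rparr>)"
proof -
  have "finite {\<one>}" "{\<one>} \<subseteq> carrier G" by auto
  from ping_pong[OF finite[of UNIV] this] obtain a :: "bool \<Rightarrow> 'g" where a: "a \<in> UNIV \<rightarrow> carrier G"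
    and reduced: "\<And>L. L \<in> mixed_words UNIV {\<one>} \<Longrightarrow> mixed_reduced G L \<Longrightarrow> L \<noteq> [] \<Longrightarrow>
      \<one> \<otimes> mixed_eval G (\<lambda>c. c) a L \<noteq> \<one>" by (metis singletonI)
  have aG [simp]: "a i \<in> carrier G" for i using a by blast
  \<comment> \<open>If the two elements commuted, their commutator would be a non-empty reduced word
    with trivial value.\<close>
  have ab: "a False \<otimes> a True \<noteq> a True \<otimes> a False"
  proof
    assume eq: "a False \<otimes> a True = a True \<otimes> a False"
    have "a False \<otimes> (a True \<otimes> (inv a False \<otimes> inv a True)) = a False \<otimes> a True \<otimes> inv (a True \<otimes> a False)"
      by (simp add: inv_mult_group m_assoc)
    also have "\<dots> = \<one>" by (simp add: eq)
    finally show False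
      using reduced[of "[((False, True), \<one>), ((True, True), \<one>), ((False, False), \<one>), ((True, False), \<one>)]"]
      by (simp add: mixed_reduced_def letter_def flip_def)
  qed
  \<comment> \<open>\<open>is_free_group\<close> asks for a basis in the type of \<open>G\<close>,
    so the elements themselves serve as generators, while words remain indexed by
    \<open>bool\<close>.\<close>
  define S where "S = range a"
  let ?F = "free_group S" and ?b = "\<lambda>i. free_group_gen S (a i)" and ?T = "G\<lparr>carrier := {\<one>}\<rparr>"
  interpret F: group ?F by (rule group_free_group)
  interpret T: group ?T by (rule subgroup_imp_group[OF triv_subgroup])
  \<comment> \<open>A plain word is a mixed word over the trivial coefficient group
    \<open>?T\<close>, so \<open>reduced_mixed_form\<close> also covers the free group.\<close>
  have triv: "group_hom ?T ?F (\<lambda>_. \<one>\<^bsub>?F\<^esub>)"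
    by unfold_locales (simp add: hom_def)
  have b: "?b \<in> UNIV \<rightarrow> carrier ?F"
    using free_group_gen_closed[of _ S] by (auto simp: S_def)
  obtain h where h: "h \<in> hom ?F G" "\<And>s. s \<in> S \<Longrightarrow> h (free_group_gen S s) = s"
  proof (rule free_group_universal[OF is_group])
    show "(\<lambda>s. s) \<in> S \<rightarrow> carrier G" by (auto simp: S_def)
  qed blast
  interpret h: group_hom ?F G h by unfold_locales (rule h)
  have hb: "h (?b i) = a i" for i using h(2) by (simp add: S_def)
  \<comment> \<open>The kernel is trivial: a kernel element in reduced form would contradict
    \<open>reduced\<close> unless its word is empty.\<close>
  have inj: "x = \<one>\<^bsub>?F\<^esub>" if x: "x \<in> carrier ?F" "h x = \<one>" for x
  proof -
    let ?N = "generate ?F ((\<lambda>_. \<one>\<^bsub>?F\<^esub>) ` carrier ?T \<union> range ?b)"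
    have "subgroup ?N ?F" using b by (intro F.generate_is_subgroup) auto
    then have "carrier ?F \<subseteq> ?N"
      by (rule free_group_carrier_subset) (auto simp: S_def intro: generate.incl)
    then have "x \<in> ?N" using x by blast
    then obtain g L where L: "L \<in> mixed_words UNIV (carrier ?T)" "mixed_reduced ?T L"
      and x_eq: "x = \<one>\<^bsub>?F\<^esub> \<otimes>\<^bsub>?F\<^esub> mixed_eval ?F (\<lambda>_. \<one>\<^bsub>?F\<^esub>) ?b L"
      by (rule reduced_mixed_form[OF triv b])
    have one: "(\<lambda>_. \<one>\<^bsub>?F\<^esub>) \<in> carrier ?T \<rightarrow> carrier ?F" by auto
    have "h x = \<one> \<otimes> mixed_eval G (\<lambda>c. c) a L"
      using h.hom_mixed_eval[OF b one L(1), of a "\<lambda>c. c"] F.mixed_eval_closed[OF b one L(1)] hb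
        mixed_eval_closed[OF a _ L(1), of "\<lambda>c. c"]
      by (simp add: x_eq)
    then have "L = []"
      using reduced[of L] L x(2) by (auto simp: mixed_reduced_def)
    then show ?thesis by (simp add: x_eq)
  qed
  let ?H = "h ` carrier ?F"
  have H: "subgroup ?H G" by (rule h.img_is_subgroup)
  have "h \<in> iso ?F (G\<lparr>carrier := ?H\<rparr>)"
    using inj h.inj_on_one_iff by (auto simp: iso_def bij_betw_def hom_def)
  then have "is_free_group (G\<lparr>carrier := ?H\<rparr>)"
    unfolding is_free_group_def is_iso_def using subgroup_imp_group[OF H] by blast
  moreover have "\<not> comm_group (G\<lparr>carrier := ?H\<rparr>)"
  proof
    assume "comm_group (G\<lparr>carrier := ?H\<rparr>)"
    moreover have "a i \<in> ?H" for i
      using b hb by (metis PiE UNIV_I imageI)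
    ultimately show False
      using ab comm_groupE(4)[of "G\<lparr>carrier := ?H\<rparr>" "a False" "a True"] by simp
  qed
  ultimately show ?thesis using H by blast
qed

end

theorem lemma2p4:
  fixes G :: "('g, 'm) monoid_scheme" and X :: "'x topology" and \<phi> :: "'g \<Rightarrow> 'x \<Rightarrow> 'x"
  assumes "group G"
    and "Hausdorff_space X"
    and "infinite (topspace X) \<or> card (topspace X) > 2"
    and "action_by_homeos G X \<phi>"
    and "topologically_free G X \<phi>"
    and "extremely_proximal G X \<phi>"
  shows "mixed_identity_free G \<and>
    (\<exists>H. subgroup H G \<and> is_free_group (G\<lparr>carrier := H\<rparr>) \<and> \<not> comm_group (G\<lparr>carrier := H\<rparr>))"
proof -
  have "ep_action G X \<phi>"
    using assms unfolding ep_action_def ep_action_axioms_def action_by_homeos_def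
    by (auto dest: homeomorphic_imp_continuous_map)
  then show ?thesis
    using ep_action.mixed_identity_free ep_action.contains_free_subgroup by blast
qed

end
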